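(* Let $G$ be a countable group whose lower central series $(G_k)_{k\ge 0}$ satisfies $\bigcap_{k=0}^\infty G_k=\{1\}$, let $\Bbbk$ be a field, and let $\preceq\in\mathrm{ZR}(G)$ be a standard preorder, so that $\nu_\preceq$ is a standard valuation. Let $h_0\in G_0\setminus G_1$ be such that $h_0\succ 1$, and let $P\in\mathbb{K}^{\Bbbk}_G$. Then: (1) If $\nu_\preceq(P)=\overline{g_0}$ for some $g_0\in G_0\setminus G_1$ such that $g_0\preceq h_0^{-1}$, then $x^{g_0^{-1}h_0}P(x)\in\mathfrak{m}_{\nu_\preceq}$. (2) Otherwise, $x^{h_0}P(x)\in\mathfrak{m}_{\nu_\preceq}$.
   Context: $\mathrm{ZR}(G)$ is the set of bi-invariant preorders on $G$: binary relations $\preceq$ that are total ($u\preceq v$ or $v\preceq u$ for all $u,v\in G$), transitive, and satisfy $u\preceq v\Rightarrow wu\preceq wv$ and $uw\preceq vw$. Write $u\prec v$ if $u\preceq v$ and not $v\preceq u$; $u\sim_\preceq v$ if $u\preceq v$ and $v\preceq u$. Lower central series: $G_0=G$ and $G_{k+1}=[G,G_k]$. A preorder $\preceq\in\mathrm{ZR}(G)$ is standard if for every $k\ge0$ and every $g\in G_k\setminus G_{k+1}$ which is positive (i.e. $g\succ1$), all elements of $gG_{k+1}$ are positive. For $\preceq\in\mathrm{ZR}(G)$, $G_\preceq=\{u\in G\mid u\sim_\preceq1\}$ is a normal subgroup, and $\preceq$ induces a bi-invariant total order on $G/G_\preceq$, still denoted $\preceq$ (also written $\le$, $<$). For $g\in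 G$, $\overline{g}$ denotes its class in $G/G_\preceq$. $\mathbb{K}^{\Bbbk}_G$ is the ring of (finite) sums $\sum_{g\in G}a_gx^g$ with $a_g\in\Bbbk$, with termwise addition and multiplication determined by $x^gx^{g'}=x^{gg'}$. The monomial valuation $\nu_\preceq:\mathbb{K}^{\Bbbk}_G\to G/G_\preceq\cup\{\infty\}$ associated with $\preceq$ is the one with $\nu_\preceq(x^g)=\overline{g}$, that is, $\nu_\preceq\left(\sum_g a_gx^g\right)=\min\{\overline{g}\mid a_g\ne0\}$ for a nonzero sum, and $\nu_\preceq(0)=\infty$, where $\infty\succ\overline{g}$ for all $g$. It is called standard if $\preceq$ is a standard preorder. The maximal ideal of its valuation ring is given by $\mathfrak{m}_{\nu_\preceq}=\{Q\mid \nu_\preceq(Q)\succ1\}$. *)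

theory Defs
  imports "HOL-Algebra.Algebra" "HOL-Library.Countable_Set"
begin

section \<open>Lower central series\<close>

(* The commutator convention is that of derived_set in HOL-Algebra. *)
primrec lower_central :: "('a, 'm) monoid_scheme \<Rightarrow> nat \<Rightarrow> 'a set" where
  "lower_central G 0 = carrier G"
| "lower_central G (Suc k) =
     generate G (\<Union>u\<in>carrier G. \<Union>v\<in>lower_central G k.
       {u \<otimes>\<^bsub>G\<^esub> v \<otimes>\<^bsub>G\<^esub> inv\<^bsub>G\<^esub> u \<otimes>\<^bsub>G\<^esub> inv\<^bsub>G\<^esub> v})"


section \<open>Bi-invariant preorders\<close>

(* A preorder on G is a relation contained in carrier G \<times> carrier G, and (u, v) \<in> r is read
   "u \<preceq> v". The predicate total_on only speaks about distinct elements; the diagonal case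
   of totality is the reflexivity contained in preorder_on. *)
definition ZR :: "('a, 'm) monoid_scheme \<Rightarrow> 'a rel set" where
  "ZR G = {r. preorder_on (carrier G) r \<and> total_on (carrier G) r \<and>
     (\<forall>u\<in>carrier G. \<forall>v\<in>carrier G. \<forall>w\<in>carrier G. (u, v) \<in> r \<longrightarrow>
        (w \<otimes>\<^bsub>G\<^esub> u, w \<otimes>\<^bsub>G\<^esub> v) \<in> r \<and> (u \<otimes>\<^bsub>G\<^esub> w, v \<otimes>\<^bsub>G\<^esub> w) \<in> r)}"

definition strictly :: "'a rel \<Rightarrow> 'a \<Rightarrow> 'a \<Rightarrow> bool" where
  "strictly r u v \<longleftrightarrow> (u, v) \<in> r \<and> (v, u) \<notin> r"

definition equivalent :: "'a rel \<Rightarrow> 'a \<Rightarrow> 'a \<Rightarrow> bool" where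
  "equivalent r u v \<longleftrightarrow> (u, v) \<in> r \<and> (v, u) \<in> r"

definition positive :: "('a, 'm) monoid_scheme \<Rightarrow> 'a rel \<Rightarrow> 'a \<Rightarrow> bool" where
  "positive G r g \<longleftrightarrow> strictly r \<one>\<^bsub>G\<^esub> g"

definition standard_preorder :: "('a, 'm) monoid_scheme \<Rightarrow> 'a rel \<Rightarrow> bool" where
  "standard_preorder G r \<longleftrightarrow> r \<in> ZR G \<and>
     (\<forall>k. \<forall>g \<in> lower_central G k - lower_central G (Suc k). positive G r g \<longrightarrow>
        (\<forall>u \<in> g <#\<^bsub>G\<^esub> lower_central G (Suc k). positive G r u))"


section \<open>The ordered quotient\<close>

definition residue_subgroup :: "('a, 'm) monoid_scheme \<Rightarrow> 'a rel \<Rightarrow> 'a set" where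
  "residue_subgroup G r = {u \<in> carrier G. equivalent r u \<one>\<^bsub>G\<^esub>}"

abbreviation quotient_group :: "('a, 'm) monoid_scheme \<Rightarrow> 'a rel \<Rightarrow> 'a set monoid" where
  "quotient_group G r \<equiv> G Mod residue_subgroup G r"

(* Elements of G Mod N are right cosets, which are also left cosets since N is normal. *)
definition quotient_class :: "('a, 'm) monoid_scheme \<Rightarrow> 'a rel \<Rightarrow> 'a \<Rightarrow> 'a set" where
  "quotient_class G r g = residue_subgroup G r #>\<^bsub>G\<^esub> g"

definition quotient_order :: "('a, 'm) monoid_scheme \<Rightarrow> 'a rel \<Rightarrow> 'a set rel" where
  "quotient_order G r = {(quotient_class G r u, quotient_class G r v) | u v. (u, v) \<in> r}"

datatype 'b with_infinity = Fin 'b | Infinity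

fun strictly_infinity :: "'b rel \<Rightarrow> 'b with_infinity \<Rightarrow> 'b with_infinity \<Rightarrow> bool" where
  "strictly_infinity r (Fin a) (Fin b) \<longleftrightarrow> strictly r a b"
| "strictly_infinity r (Fin a) Infinity \<longleftrightarrow> True"
| "strictly_infinity r Infinity _ \<longleftrightarrow> False"


section \<open>The group ring\<close>

definition gr_support :: "('k, 'n) ring_scheme \<Rightarrow> ('a \<Rightarrow> 'k) \<Rightarrow> 'a set" where
  "gr_support K P = {g. P g \<noteq> \<zero>\<^bsub>K\<^esub>}"

(* The sum of the a_g x^g is encoded by its coefficient function g \<mapsto> a_g, extended by zero
   outside the carrier of G. The sum in the product ranges over a finite set, because the
   factors have finite support. *)
definition group_ring :: "('k, 'n) ring_scheme \<Rightarrow> ('a, 'm) monoid_scheme \<Rightarrow> ('a \<Rightarrow> 'k) ring" where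
  "group_ring K G =
     \<lparr>carrier = {P. (\<forall>g. P g \<in> carrier K) \<and> gr_support K P \<subseteq> carrier G \<and> finite (gr_support K P)},
      monoid.mult = (\<lambda>P Q g.
        finsum K (\<lambda>(u, v). P u \<otimes>\<^bsub>K\<^esub> Q v)
          {(u, v) \<in> gr_support K P \<times> gr_support K Q. u \<otimes>\<^bsub>G\<^esub> v = g}),
      monoid.one = (\<lambda>g. if g = \<one>\<^bsub>G\<^esub> then \<one>\<^bsub>K\<^esub> else \<zero>\<^bsub>K\<^esub>),
      ring.zero = (\<lambda>g. \<zero>\<^bsub>K\<^esub>),
      ring.add = (\<lambda>P Q g. P g \<oplus>\<^bsub>K\<^esub> Q g)\<rparr>"

(* group_monom K g is x^g. *)
definition group_monom :: "('k, 'n) ring_scheme \<Rightarrow> 'a \<Rightarrow> 'a \<Rightarrow> 'k" where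
  "group_monom K g = (\<lambda>h. if h = g then \<one>\<^bsub>K\<^esub> else \<zero>\<^bsub>K\<^esub>)"

lemma gr_support_group_monom:
  assumes "field K"
  shows "gr_support K (group_monom K g) = {g}"
proof -
  interpret field K by fact
  show ?thesis
    by (auto simp: gr_support_def group_monom_def)
qed

lemma group_monom_closed:
  assumes "field K" "g \<in> carrier G"
  shows "group_monom K g \<in> carrier (group_ring K G)"
proof -
  interpret field K by fact
  show ?thesis
    using assms by (simp add: group_ring_def gr_support_group_monom) (simp add: group_monom_def)
qed

lemma group_monom_mult:
  assumes "field K"
  shows "group_monom K g \<otimes>\<^bsub>group_ring K G\<^esub> group_monom K h = group_monom K (g \<otimes>\<^bsub>G\<^esub> h)"
proof
  fix a
  interpret field K by fact
  have "{(u, v) \<in> {g} \<times> {h}. u \<otimes>\<^bsub>G\<^esub> v = a} = (if a = g \<otimes>\<^bsub>G\<^esub> h then {(g, h)} else {})"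
    by auto
  then have "(group_monom K g \<otimes>\<^bsub>group_ring K G\<^esub> group_monom K h) a =
      finsum K (\<lambda>(u, v). group_monom K g u \<otimes>\<^bsub>K\<^esub> group_monom K h v)
        (if a = g \<otimes>\<^bsub>G\<^esub> h then {(g, h)} else {})"
    by (simp only: group_ring_def monoid.simps gr_support_group_monom[OF assms])
  also have "\<dots> = group_monom K (g \<otimes>\<^bsub>G\<^esub> h) a"
    by (simp add: group_monom_def finsum_insert)
  finally show "(group_monom K g \<otimes>\<^bsub>group_ring K G\<^esub> group_monom K h) a =
      group_monom K (g \<otimes>\<^bsub>G\<^esub> h) a" .
qed


section \<open>The monomial valuation\<close>

(* The minimum is taken in the totally ordered group G / G_\<preceq>. *)
definition monomial_valuation ::
  "('k, 'n) ring_scheme \<Rightarrow> ('a, 'm) monoid_scheme \<Rightarrow> 'a rel \<Rightarrow> ('a \<Rightarrow> 'k) \<Rightarrow> 'a set with_infinity"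
  where
  "monomial_valuation K G r P =
     (if P = \<zero>\<^bsub>group_ring K G\<^esub> then Infinity
      else Fin (THE c. c \<in> quotient_class G r ` gr_support K P \<and>
                 (\<forall>d \<in> quotient_class G r ` gr_support K P. (c, d) \<in> quotient_order G r)))"

definition valuation_maximal_ideal ::
  "('k, 'n) ring_scheme \<Rightarrow> ('a, 'm) monoid_scheme \<Rightarrow> 'a rel \<Rightarrow> ('a \<Rightarrow> 'k) set" where
  "valuation_maximal_ideal K G r =
     {Q \<in> carrier (group_ring K G).
        strictly_infinity (quotient_order G r)
          (Fin \<one>\<^bsub>quotient_group G r\<^esub>) (monomial_valuation K G r Q)}"

end

theory Submission imports Defs begin

text \<open>
  Everything rests on one reformulation: an element of the group ring lies in the maximal ideal of
  \<open>\<nu>\<close> exactly when every group element in its support is positive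
  (\<open>mem_valuation_maximal_ideal_iff\<close>). As multiplication by \<open>x\<^sup>a\<close> translates supports by \<open>a\<close>
  (\<open>gr_support_group_monom_mult\<close>) and translations preserve the preorder, for nonzero \<open>P\<close> it
  suffices to show that \<open>a\<close> times a least element \<open>p\<close> of the support of \<open>P\<close> is positive.

  If \<open>\<nu> P\<close> is the class of \<open>g\<^sub>0\<close>, then \<open>p \<sim> g\<^sub>0\<close>, and \<open>a = g\<^sub>0\<inverse>h\<^sub>0\<close> gives the element
  \<open>g\<^sub>0\<inverse>h\<^sub>0g\<^sub>0\<close>, a conjugate of the positive element \<open>h\<^sub>0\<close>. For \<open>a = h\<^sub>0\<close> the product \<open>h\<^sub>0p\<close> can
  fail to be positive only if \<open>p \<preceq> h\<^sub>0\<inverse>\<close>. If \<open>p\<close> lies outside \<open>G\<^sub>1\<close>, then \<open>g\<^sub>0 = p\<close> falls under the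
  first case. If \<open>p\<close> lies in \<open>G\<^sub>1\<close>, then \<open>h\<^sub>0p\<close> lies in the coset \<open>h\<^sub>0G\<^sub>1\<close>, all of whose elements are
  positive because the preorder is standard.
\<close>


section \<open>Bi-invariant preorders\<close>

locale bi_preordered_group = group G for G (structure) +
  fixes r :: "'a rel"
  assumes ZR: "r \<in> ZR G"
begin

lemma le_closed: "(u, v) \<in> r \<Longrightarrow> u \<in> carrier G \<and> v \<in> carrier G"
  using ZR by (auto simp: ZR_def preorder_on_def refl_on_def)

lemma le_refl: "u \<in> carrier G \<Longrightarrow> (u, u) \<in> r"
  using ZR by (auto simp: ZR_def preorder_on_def refl_on_def)

lemma le_trans: "(u, v) \<in> r \<Longrightarrow> (v, w) \<in> r \<Longrightarrow> (u, w) \<in> r"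
  using ZR by (auto simp: ZR_def preorder_on_def dest: transD)

lemma le_total: "u \<in> carrier G \<Longrightarrow> v \<in> carrier G \<Longrightarrow> (u, v) \<in> r \<or> (v, u) \<in> r"
  using ZR le_refl by (cases "u = v") (auto simp: ZR_def total_on_def)

lemma not_le_iff_strictly:
  "u \<in> carrier G \<Longrightarrow> v \<in> carrier G \<Longrightarrow> (u, v) \<notin> r \<longleftrightarrow> strictly r v u"
  using le_total by (auto simp: strictly_def)

lemma le_mult_left: "w \<in> carrier G \<Longrightarrow> (u, v) \<in> r \<Longrightarrow> (w \<otimes> u, w \<otimes> v) \<in> r"
  using ZR le_closed by (fastforce simp: ZR_def)

lemma le_mult_right: "w \<in> carrier G \<Longrightarrow> (u, v) \<in> r \<Longrightarrow> (u \<otimes> w, v \<otimes> w) \<in> r"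
  using ZR le_closed by (fastforce simp: ZR_def)

lemma le_mult_left_iff:
  assumes "u \<in> carrier G" "v \<in> carrier G" "w \<in> carrier G"
  shows "(w \<otimes> u, w \<otimes> v) \<in> r \<longleftrightarrow> (u, v) \<in> r"
  using le_mult_left[of "inv w" "w \<otimes> u" "w \<otimes> v"] le_mult_left[of w u v] assms
  by (auto simp: m_assoc[symmetric])

lemma le_mult_right_iff:
  assumes "u \<in> carrier G" "v \<in> carrier G" "w \<in> carrier G"
  shows "(u \<otimes> w, v \<otimes> w) \<in> r \<longleftrightarrow> (u, v) \<in> r"
  using le_mult_right[of "inv w" "u \<otimes> w" "v \<otimes> w"] le_mult_right[of w u v] assms
  by (auto simp: m_assoc)

lemma strictly_le_trans: "strictly r u v \<Longrightarrow> (v, w) \<in> r \<Longrightarrow> strictly r u w"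
  by (auto simp: strictly_def intro: le_trans)

lemma strictly_one_conjugate:
  assumes "strictly r \<one> h" "g \<in> carrier G"
  shows "strictly r \<one> (inv g \<otimes> h \<otimes> g)"
proof -
  have h: "h \<in> carrier G"
    using assms le_closed by (auto simp: strictly_def)
  have "(\<one>, inv g \<otimes> h \<otimes> g) \<in> r \<longleftrightarrow> (\<one>, h) \<in> r" "(inv g \<otimes> h \<otimes> g, \<one>) \<in> r \<longleftrightarrow> (h, \<one>) \<in> r"
    using assms h le_mult_right_iff[of "inv g" "inv g \<otimes> h" g] le_mult_left_iff[of \<one> h "inv g"]
      le_mult_right_iff[of "inv g \<otimes> h" "inv g" g] le_mult_left_iff[of h \<one> "inv g"] by auto
  then show ?thesis
    using assms by (simp add: strictly_def)
qed

lemma finite_has_least: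
  assumes "finite S" "S \<noteq> {}" "S \<subseteq> carrier G"
  shows "\<exists>p\<in>S. \<forall>q\<in>S. (p, q) \<in> r"
  using assms
proof (induction rule: finite_ne_induct)
  case (singleton x)
  then show ?case by (auto intro: le_refl)
next
  case (insert x S)
  then obtain p where p: "p \<in> S" "\<forall>q\<in>S. (p, q) \<in> r" by auto
  moreover from p insert.prems have "(p, x) \<in> r \<or> (x, p) \<in> r" "(x, x) \<in> r"
    using le_total[of p x] le_refl[of x] by auto
  ultimately show ?case
    by (metis insert_iff le_trans)
qed


section \<open>The ordered quotient\<close>

text \<open>
  Translating by \<open>u\<close> turns equivalence to \<open>\<one>\<close> into equivalence to \<open>u\<close>. With cosets read as
  equivalence classes, the order on the quotient is the usual order on the classes of a preorder.
\<close>

lemma quotient_class_eq: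
  assumes u: "u \<in> carrier G"
  shows "quotient_class G r u = {w \<in> carrier G. equivalent r w u}"
proof (intro equalityI subsetI)
  fix w assume "w \<in> quotient_class G r u"
  then obtain n where "n \<in> carrier G" "equivalent r n \<one>" "w = n \<otimes> u"
    by (auto simp: quotient_class_def residue_subgroup_def r_coset_def)
  then show "w \<in> {w \<in> carrier G. equivalent r w u}"
    using u le_mult_right[of u n \<one>] le_mult_right[of u \<one> n] by (simp add: equivalent_def)
next
  fix w assume "w \<in> {w \<in> carrier G. equivalent r w u}"
  then have w: "w \<in> carrier G" "(w, u) \<in> r" "(u, w) \<in> r"
    by (auto simp: equivalent_def)
  have "equivalent r (w \<otimes> inv u) \<one>"
    using u w le_mult_right[of "inv u" w u] le_mult_right[of "inv u" u w]
    by (simp add: equivalent_def)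
  moreover have "w = (w \<otimes> inv u) \<otimes> u"
    using u w by (simp add: m_assoc)
  ultimately show "w \<in> quotient_class G r u"
    using u w unfolding quotient_class_def residue_subgroup_def r_coset_def by blast
qed

lemma quotient_class_eq_iff:
  assumes "u \<in> carrier G" "v \<in> carrier G"
  shows "quotient_class G r u = quotient_class G r v \<longleftrightarrow> equivalent r u v"
proof
  assume "quotient_class G r u = quotient_class G r v"
  then have "u \<in> quotient_class G r v"
    using assms le_refl by (auto simp: quotient_class_eq equivalent_def)
  then show "equivalent r u v"
    using assms by (simp add: quotient_class_eq)
next
  assume "equivalent r u v"
  then show "quotient_class G r u = quotient_class G r v"
    using assms by (auto simp: quotient_class_eq equivalent_def intro: le_trans)
qed

lemma residue_subgroup_eq_quotient_class: "residue_subgroup G r = quotient_class G r \<one>"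
  by (simp add: quotient_class_eq residue_subgroup_def)

lemma quotient_order_iff:
  assumes "u \<in> carrier G" "v \<in> carrier G"
  shows "(quotient_class G r u, quotient_class G r v) \<in> quotient_order G r \<longleftrightarrow> (u, v) \<in> r"
proof
  assume "(quotient_class G r u, quotient_class G r v) \<in> quotient_order G r"
  then obtain u' v' where "quotient_class G r u = quotient_class G r u'"
      "quotient_class G r v = quotient_class G r v'" "(u', v') \<in> r"
    by (auto simp: quotient_order_def)
  then show "(u, v) \<in> r"
    using assms le_closed[of u' v'] quotient_class_eq_iff
    by (auto simp: equivalent_def intro: le_trans)
qed (auto simp: quotient_order_def)


section \<open>The monomial valuation\<close>

lemma monomial_valuation_eq:
  assumes "P \<in> carrier (group_ring K G)" "p \<in> gr_support K P" "\<forall>q\<in>gr_support K P. (p, q) \<in> r"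
  shows "monomial_valuation K G r P = Fin (quotient_class G r p)"
proof -
  have supp: "gr_support K P \<subseteq> carrier G"
    using assms by (simp add: group_ring_def)
  have "P \<noteq> \<zero>\<^bsub>group_ring K G\<^esub>"
    using assms by (auto simp: group_ring_def gr_support_def)
  moreover have "(THE c. c \<in> quotient_class G r ` gr_support K P \<and>
      (\<forall>d \<in> quotient_class G r ` gr_support K P. (c, d) \<in> quotient_order G r)) =
      quotient_class G r p"
  proof (rule the_equality)
    show "quotient_class G r p \<in> quotient_class G r ` gr_support K P \<and>
        (\<forall>d \<in> quotient_class G r ` gr_support K P.
          (quotient_class G r p, d) \<in> quotient_order G r)"
      using assms supp by (auto simp: quotient_order_def)
  next
    fix c
    assume "c \<in> quotient_class G r ` gr_support K P \<and>
        (\<forall>d \<in> quotient_class G r ` gr_support K P. (c, d) \<in> quotient_order G r)"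
    then obtain q where q: "q \<in> gr_support K P" "c = quotient_class G r q"
        "(c, quotient_class G r p) \<in> quotient_order G r"
      using assms by auto
    then have "(q, p) \<in> r"
      using assms supp quotient_order_iff[of q p] by auto
    then show "c = quotient_class G r p"
      using q assms supp quotient_class_eq_iff[of q p] by (auto simp: equivalent_def)
  qed
  ultimately show ?thesis
    by (simp add: monomial_valuation_def)
qed

lemma monomial_valuation_attained:
  assumes "P \<in> carrier (group_ring K G)" "gr_support K P \<noteq> {}"
  obtains p where "p \<in> gr_support K P" "p \<in> carrier G" "\<forall>q\<in>gr_support K P. (p, q) \<in> r"
    "monomial_valuation K G r P = Fin (quotient_class G r p)"
proof -
  have "finite (gr_support K P)" "gr_support K P \<subseteq> carrier G"
    using assms by (auto simp: group_ring_def)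
  then show ?thesis
    using finite_has_least[of "gr_support K P"] monomial_valuation_eq assms that by blast
qed

lemma monomial_valuation_le_support:
  assumes P: "P \<in> carrier (group_ring K G)" and g: "g \<in> carrier G"
    and val: "monomial_valuation K G r P = Fin (quotient_class G r g)"
    and q: "q \<in> gr_support K P"
  shows "(g, q) \<in> r"
proof -
  obtain p where p: "p \<in> carrier G" "\<forall>q\<in>gr_support K P. (p, q) \<in> r"
      "monomial_valuation K G r P = Fin (quotient_class G r p)"
    using monomial_valuation_attained[OF P] q by blast
  then have "equivalent r g p"
    using val g quotient_class_eq_iff[of g p] by simp
  then show ?thesis
    using p q by (auto simp: equivalent_def intro: le_trans)
qed

text \<open>
  The valuation is the class of a least element of the support, and this element is positive if
  and only if all elements above it are. The empty support fits in: the zero element has valuation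
  \<open>\<infinity>\<close> and lies in the ideal.
\<close>

lemma mem_valuation_maximal_ideal_iff:
  assumes P: "P \<in> carrier (group_ring K G)"
  shows "P \<in> valuation_maximal_ideal K G r \<longleftrightarrow> (\<forall>q\<in>gr_support K P. strictly r \<one> q)"
proof (cases "gr_support K P = {}")
  case True
  then have "P = \<zero>\<^bsub>group_ring K G\<^esub>"
    by (auto simp: gr_support_def group_ring_def)
  then show ?thesis
    using P True by (simp add: valuation_maximal_ideal_def monomial_valuation_def)
next
  case False
  then obtain p where p: "p \<in> gr_support K P" "p \<in> carrier G" "\<forall>q\<in>gr_support K P. (p, q) \<in> r"
      "monomial_valuation K G r P = Fin (quotient_class G r p)"
    using monomial_valuation_attained[OF P] by blast
  have "P \<in> valuation_maximal_ideal K G r \<longleftrightarrow> strictly r \<one> p"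
    using P p by (simp add: valuation_maximal_ideal_def residue_subgroup_eq_quotient_class
        strictly_def quotient_order_iff)
  also have "\<dots> \<longleftrightarrow> (\<forall>q\<in>gr_support K P. strictly r \<one> q)"
    using p strictly_le_trans by blast
  finally show ?thesis .
qed

end


section \<open>Multiplication by a monomial\<close>

lemma group_monom_mult_apply:
  assumes "field K" "group G" "P \<in> carrier (group_ring K G)" "a \<in> carrier G" "g \<in> carrier G"
  shows "(group_monom K a \<otimes>\<^bsub>group_ring K G\<^esub> P) g = P (inv\<^bsub>G\<^esub> a \<otimes>\<^bsub>G\<^esub> g)"
proof -
  interpret K: field K by fact
  interpret group G by fact
  let ?b = "inv\<^bsub>G\<^esub> a \<otimes>\<^bsub>G\<^esub> g"
  have P: "\<And>u. P u \<in> carrier K" "gr_support K P \<subseteq> carrier G"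
    using assms by (auto simp: group_ring_def)
  have "a \<otimes>\<^bsub>G\<^esub> v = g \<longleftrightarrow> v = ?b" if "v \<in> carrier G" for v
    using that assms inv_solve_left[of v a g] by auto
  then have "a \<otimes>\<^bsub>G\<^esub> v = g \<longleftrightarrow> v = ?b" if "v \<in> gr_support K P" for v
    using that P by blast
  then have "{(u, v) \<in> {a} \<times> gr_support K P. u \<otimes>\<^bsub>G\<^esub> v = g} =
      {(u, v) \<in> {a} \<times> gr_support K P. v = ?b}"
    by blast
  also have "\<dots> = (if P ?b = \<zero>\<^bsub>K\<^esub> then {} else {(a, ?b)})"
    by (auto simp: gr_support_def)
  finally have "(group_monom K a \<otimes>\<^bsub>group_ring K G\<^esub> P) g =
      finsum K (\<lambda>(u, v). group_monom K a u \<otimes>\<^bsub>K\<^esub> P v)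
        (if P ?b = \<zero>\<^bsub>K\<^esub> then {} else {(a, ?b)})"
    by (simp only: group_ring_def monoid.simps gr_support_group_monom[OF assms(1)])
  also have "\<dots> = P ?b"
    using P by (simp add: group_monom_def K.finsum_insert)
  finally show ?thesis .
qed

text \<open>
  Elements of the group ring are functions on the whole type, so their vanishing off the group has
  to be tracked separately.
\<close>

lemma group_monom_mult_apply_outside:
  assumes "field K" "group G" "P \<in> carrier (group_ring K G)" "a \<in> carrier G" "g \<notin> carrier G"
  shows "(group_monom K a \<otimes>\<^bsub>group_ring K G\<^esub> P) g = \<zero>\<^bsub>K\<^esub>"
proof -
  interpret K: field K by fact
  interpret group G by fact
  have "gr_support K P \<subseteq> carrier G"
    using assms by (auto simp: group_ring_def)
  then have "{(u, v) \<in> {a} \<times> gr_support K P. u \<otimes>\<^bsub>G\<^esub> v = g} = {}"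
    using assms by auto
  then show ?thesis
    by (simp only: group_ring_def monoid.simps gr_support_group_monom[OF assms(1)]
        K.finsum_empty)
qed

lemma gr_support_group_monom_mult:
  assumes "field K" "group G" "P \<in> carrier (group_ring K G)" "a \<in> carrier G"
  shows "gr_support K (group_monom K a \<otimes>\<^bsub>group_ring K G\<^esub> P) = (\<lambda>q. a \<otimes>\<^bsub>G\<^esub> q) ` gr_support K P"
    (is "gr_support K ?Q = _")
proof -
  interpret group G by fact
  have P: "gr_support K P \<subseteq> carrier G"
    using assms by (auto simp: group_ring_def)
  show ?thesis
  proof (intro equalityI subsetI)
    fix g assume g: "g \<in> gr_support K ?Q"
    then have "g \<in> carrier G"
      using group_monom_mult_apply_outside[OF assms] by (auto simp: gr_support_def)
    moreover from this have "inv\<^bsub>G\<^esub> a \<otimes>\<^bsub>G\<^esub> g \<in> gr_support K P"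
      using g group_monom_mult_apply[OF assms] by (simp add: gr_support_def)
    moreover have "g = a \<otimes>\<^bsub>G\<^esub> (inv\<^bsub>G\<^esub> a \<otimes>\<^bsub>G\<^esub> g)"
      using assms \<open>g \<in> carrier G\<close> by (simp add: m_assoc[symmetric])
    ultimately show "g \<in> (\<lambda>q. a \<otimes>\<^bsub>G\<^esub> q) ` gr_support K P"
      by blast
  next
    fix g assume "g \<in> (\<lambda>q. a \<otimes>\<^bsub>G\<^esub> q) ` gr_support K P"
    then obtain q where "q \<in> gr_support K P" "q \<in> carrier G" "g = a \<otimes>\<^bsub>G\<^esub> q"
      using P by auto
    then show "g \<in> gr_support K ?Q"
      using assms group_monom_mult_apply[OF assms, of g]
      by (simp add: gr_support_def m_assoc[symmetric])
  qed
qed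

lemma group_monom_mult_closed:
  assumes "field K" "group G" "P \<in> carrier (group_ring K G)" "a \<in> carrier G"
  shows "group_monom K a \<otimes>\<^bsub>group_ring K G\<^esub> P \<in> carrier (group_ring K G)" (is "?Q \<in> _")
proof -
  interpret K: field K by fact
  interpret group G by fact
  have P: "\<And>u. P u \<in> carrier K" "gr_support K P \<subseteq> carrier G" "finite (gr_support K P)"
    using assms by (auto simp: group_ring_def)
  have "?Q g \<in> carrier K" for g
    using P group_monom_mult_apply[OF assms] group_monom_mult_apply_outside[OF assms]
    by (cases "g \<in> carrier G") auto
  moreover have "gr_support K ?Q \<subseteq> carrier G" "finite (gr_support K ?Q)"
    using P assms gr_support_group_monom_mult[OF assms] by auto
  ultimately show ?thesis
    by (simp add: group_ring_def)
qed

text \<open>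
  The common step of both cases: positivity need only be tested on a lower bound \<open>g\<close> of the support,
  for instance on any representative of the valuation of a nonzero \<open>P\<close>.
\<close>

lemma (in bi_preordered_group) group_monom_mult_mem_valuation_maximal_ideal:
  assumes "field K" "P \<in> carrier (group_ring K G)" "a \<in> carrier G"
    and pos: "strictly r \<one> (a \<otimes> g)" and least: "\<forall>q\<in>gr_support K P. (g, q) \<in> r"
  shows "group_monom K a \<otimes>\<^bsub>group_ring K G\<^esub> P \<in> valuation_maximal_ideal K G r"
proof -
  have "strictly r \<one> (a \<otimes> q)" if "q \<in> gr_support K P" for q
    using pos least that assms(3) by (blast intro: strictly_le_trans le_mult_left)
  then show ?thesis
    using mem_valuation_maximal_ideal_iff[OF group_monom_mult_closed[OF assms(1) is_group assms(2,3)]]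
      gr_support_group_monom_mult[OF assms(1) is_group assms(2,3)]
    by simp
qed


section \<open>Monomial multiples in the maximal ideal of a standard valuation\<close>

theorem proposition5p6:
  fixes G :: "('a, 'm) monoid_scheme"
    and K :: "('k, 'n) ring_scheme"
    and r :: "'a rel"
    and h\<^sub>0 :: 'a
    and P :: "'a \<Rightarrow> 'k"
  assumes "group G"
    and "countable (carrier G)"
    and "(\<Inter>k. lower_central G k) = {\<one>\<^bsub>G\<^esub>}"
    and "field K"
    and "r \<in> ZR G"
    and "standard_preorder G r"
    and "h\<^sub>0 \<in> lower_central G 0 - lower_central G 1"
    and "strictly r \<one>\<^bsub>G\<^esub> h\<^sub>0"
    and "P \<in> carrier (group_ring K G)"
  shows "(\<forall>g\<^sub>0 \<in> lower_central G 0 - lower_central G 1.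
           monomial_valuation K G r P = Fin (quotient_class G r g\<^sub>0) \<and> (g\<^sub>0, inv\<^bsub>G\<^esub> h\<^sub>0) \<in> r \<longrightarrow>
           group_monom K (inv\<^bsub>G\<^esub> g\<^sub>0 \<otimes>\<^bsub>G\<^esub> h\<^sub>0) \<otimes>\<^bsub>group_ring K G\<^esub> P
             \<in> valuation_maximal_ideal K G r) \<and>
         (\<not> (\<exists>g\<^sub>0 \<in> lower_central G 0 - lower_central G 1.
           monomial_valuation K G r P = Fin (quotient_class G r g\<^sub>0) \<and> (g\<^sub>0, inv\<^bsub>G\<^esub> h\<^sub>0) \<in> r) \<longrightarrow>
         group_monom K h\<^sub>0 \<otimes>\<^bsub>group_ring K G\<^esub> P \<in> valuation_maximal_ideal K G r)"
proof (intro conjI ballI impI)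
  interpret bi_preordered_group G r
    using assms(1,5) by (simp add: bi_preordered_group_def bi_preordered_group_axioms_def)
  have h: "h\<^sub>0 \<in> carrier G"
    using assms(7) by simp
  {
    fix g\<^sub>0 assume "g\<^sub>0 \<in> lower_central G 0 - lower_central G 1"
      and g: "monomial_valuation K G r P = Fin (quotient_class G r g\<^sub>0) \<and> (g\<^sub>0, inv\<^bsub>G\<^esub> h\<^sub>0) \<in> r"
    then have "g\<^sub>0 \<in> carrier G"
      by simp
    then show "group_monom K (inv\<^bsub>G\<^esub> g\<^sub>0 \<otimes>\<^bsub>G\<^esub> h\<^sub>0) \<otimes>\<^bsub>group_ring K G\<^esub> P
        \<in> valuation_maximal_ideal K G r"
      using g h assms(4,8,9) strictly_one_conjugate[of h\<^sub>0 g\<^sub>0]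
        monomial_valuation_le_support[of P K g\<^sub>0]
      by (intro group_monom_mult_mem_valuation_maximal_ideal[where g = g\<^sub>0]) auto
  next
    assume no: "\<not> (\<exists>g\<^sub>0 \<in> lower_central G 0 - lower_central G 1.
      monomial_valuation K G r P = Fin (quotient_class G r g\<^sub>0) \<and> (g\<^sub>0, inv\<^bsub>G\<^esub> h\<^sub>0) \<in> r)"
    show "group_monom K h\<^sub>0 \<otimes>\<^bsub>group_ring K G\<^esub> P \<in> valuation_maximal_ideal K G r"
    proof (cases "gr_support K P = {}")
      case True
      \<comment> \<open>Any lower bound of the empty support will do; \<open>\<one>\<close> makes \<open>h\<^sub>0\<one> = h\<^sub>0\<close> positive.\<close>
      then show ?thesis
        using h assms(4,8,9)
        by (intro group_monom_mult_mem_valuation_maximal_ideal[where g = "\<one>\<^bsub>G\<^esub>"]) auto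
    next
      case False
      then obtain p where p: "p \<in> carrier G" "\<forall>q\<in>gr_support K P. (p, q) \<in> r"
          "monomial_valuation K G r P = Fin (quotient_class G r p)"
        using monomial_valuation_attained[OF assms(9)] by blast
      have "strictly r \<one>\<^bsub>G\<^esub> (h\<^sub>0 \<otimes>\<^bsub>G\<^esub> p)"
      proof (cases "p \<in> lower_central G 1")
        case True
        then have "h\<^sub>0 \<otimes>\<^bsub>G\<^esub> p \<in> h\<^sub>0 <#\<^bsub>G\<^esub> lower_central G (Suc 0)"
          by (auto simp: l_coset_def)
        moreover have "\<forall>u \<in> h\<^sub>0 <#\<^bsub>G\<^esub> lower_central G (Suc 0). positive G r u"
          using assms(6-8) unfolding standard_preorder_def positive_def One_nat_def by blast
        ultimately show ?thesis
          by (simp add: positive_def)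
      next
        case False
        then have "(p, inv\<^bsub>G\<^esub> h\<^sub>0) \<notin> r"
          using no p by auto
        then have "(h\<^sub>0 \<otimes>\<^bsub>G\<^esub> p, \<one>\<^bsub>G\<^esub>) \<notin> r"
          using le_mult_left_iff[of p "inv\<^bsub>G\<^esub> h\<^sub>0" h\<^sub>0] h p by simp
        then show ?thesis
          using h p by (simp add: not_le_iff_strictly)
      qed
      then show ?thesis
        using p h assms(4,9) by (intro group_monom_mult_mem_valuation_maximal_ideal[where g = p]) auto
    qed
  }
qed

end
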